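(* $f(1/4) = 1/4$.
   Context: For $0 \le \theta < 1/2$, let $f(\theta)$ denote the least (infimum of) exponent $\phi \ge 0$ with the following property: there exist constants $c_1, c_2 > 0$ (which may depend on $\theta$) such that for every real $x \ge 1$ the interval $[x - c_1 x^{\phi}, x + c_1 x^{\phi}]$ contains an integer $n$ with $n = ab$, where $a$ and $b$ are integers lying in the interval $[x^{1/2} - c_2 x^{\theta}, x^{1/2} + c_2 x^{\theta}]$. *)

theory Defs
  imports Complex_Main
begin

definition almost_square_exponent :: "real \<Rightarrow> real \<Rightarrow> bool" where
  "almost_square_exponent \<theta> \<phi> \<longleftrightarrow>
     (\<exists>c1>0. \<exists>c2>0. \<forall>x::real. x \<ge> 1 \<longrightarrow>
        (\<exists>n a b :: int. n = a * b \<and>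
           real_of_int n \<in> {x - c1 * x powr \<phi> .. x + c1 * x powr \<phi>} \<and>
           real_of_int a \<in> {x powr (1/2) - c2 * x powr \<theta> .. x powr (1/2) + c2 * x powr \<theta>} \<and>
           real_of_int b \<in> {x powr (1/2) - c2 * x powr \<theta> .. x powr (1/2) + c2 * x powr \<theta>}))"

text \<open>
  Meant for \<open>0 \<le> \<theta> < 1/2\<close>. For such \<open>\<theta>\<close> the real infimum is taken over a set that is bounded
  below by 0 and nonempty: the exponent \<open>1/2\<close> always belongs to it (take \<open>a = b = \<lfloor>sqrt x\<rfloor>\<close>).
\<close>
definition f :: "real \<Rightarrow> real" where
  "f \<theta> = Inf {\<phi>. 0 \<le> \<phi> \<and> almost_square_exponent \<theta> \<phi>}"

end

theory Submission
  imports Defs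
begin

text \<open>
  Upper bound: with \<open>u = \<lceil>sqrt x\<rceil>\<close> and \<open>v = \<lfloor>sqrt (u\<^sup>2 - x)\<rfloor>\<close>, the product \<open>(u - v) (u + v)\<close> misses
  \<open>x\<close> by at most \<open>2 sqrt (u\<^sup>2 - x) = O(x\<^bsup>1/4\<^esup>)\<close>.

  Lower bound: near \<open>x = M\<^sup>4\<close> the factors are \<open>M\<^sup>2 + p\<close> and \<open>M\<^sup>2 + q\<close> with \<open>p, q = O(M)\<close>. If the product
  is \<open>M\<^sup>4 + O(M\<^sup>2)\<close>, then \<open>p + q = O(1)\<close>, so only \<open>O(M)\<close> products occur. If the exponent \<open>\<phi>\<close> were
  below \<open>1/4\<close>, the pigeonhole principle would put one product within \<open>o(M)\<close> of two of the points
  \<open>M\<^sup>4 + j L\<close>, which are spaced by a small fixed multiple \<open>L\<close> of \<open>M\<close>.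
\<close>

lemma almost_square_exponent_quarter: "almost_square_exponent (1/4) (1/4)"
  unfolding almost_square_exponent_def
proof (intro exI[of _ "4::real"] conjI allI impI)
  fix x :: real
  assume x: "x \<ge> 1"
  define r where "r = x powr (1/4)"
  have r1: "r \<ge> 1"
    unfolding r_def using x by (simp add: ge_one_powr_ge_zero)
  have r2: "x powr (1/2) = r\<^sup>2"
    unfolding r_def power2_eq_square by (simp flip: powr_add)
  have r4: "x = r\<^sup>2 * r\<^sup>2"
    using x by (simp flip: r2 powr_add)
  have rr2: "r \<le> r\<^sup>2"
    using r1 by (simp add: power2_eq_square)
  \<comment> \<open>Rounding up makes \<open>u\<^sup>2 - x\<close> nonnegative, so its square root
    exists; as the excess is O(\<open>r\<^sup>2\<close>), that root is O(\<open>r\<close>), small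
    enough for both factors.\<close>
  define u where "u = \<lceil>r\<^sup>2\<rceil>"
  have u: "r\<^sup>2 \<le> u" "u \<le> r\<^sup>2 + 1"
    unfolding u_def by linarith+
  define d where "d = (real_of_int u)\<^sup>2 - x"
  have "r\<^sup>2 * r\<^sup>2 \<le> real_of_int u * real_of_int u"
    using u order_trans[OF zero_le_power2 u(1)] by (intro mult_mono) auto
  then have d0: "0 \<le> d"
    unfolding d_def using r4 by (simp add: power2_eq_square)
  have "real_of_int u * real_of_int u \<le> (r\<^sup>2 + 1) * (r\<^sup>2 + 1)"
    using u order_trans[OF zero_le_power2 u(1)] by (intro mult_mono) auto
  then have "d \<le> 2 * r\<^sup>2 + 1"
    unfolding d_def using r4 by (simp add: power2_eq_square algebra_simps)
  also have "\<dots> \<le> (2 * r)\<^sup>2"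
    using rr2 r1 by (simp add: power_mult_distrib)
  finally have sd: "sqrt d \<le> 2 * r"
    using r1 real_le_lsqrt by auto
  define v where "v = \<lfloor>sqrt d\<rfloor>"
  have v: "0 \<le> v" "v \<le> sqrt d" "sqrt d < v + 1"
    unfolding v_def using d0 by auto
  have vd: "(real_of_int v)\<^sup>2 \<le> d"
    using v power_mono[of "real_of_int v" "sqrt d" 2] d0 by simp
  have "d - (real_of_int v)\<^sup>2 = (sqrt d - v) * (sqrt d + v)"
    using d0 by (simp add: algebra_simps power2_eq_square)
  also have "\<dots> \<le> 1 * (sqrt d + sqrt d)"
    using v d0 by (intro mult_mono) auto
  finally have dv: "d - (real_of_int v)\<^sup>2 \<le> 4 * r"
    using sd by simp
  have n: "real_of_int ((u - v) * (u + v)) = x + (d - (real_of_int v)\<^sup>2)"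
    unfolding d_def by (simp add: power2_eq_square algebra_simps)
  show "\<exists>n a b :: int. n = a * b \<and>
      real_of_int n \<in> {x - 4 * x powr (1/4) .. x + 4 * x powr (1/4)} \<and>
      real_of_int a \<in> {x powr (1/2) - 4 * x powr (1/4) .. x powr (1/2) + 4 * x powr (1/4)} \<and>
      real_of_int b \<in> {x powr (1/2) - 4 * x powr (1/4) .. x powr (1/2) + 4 * x powr (1/4)}"
    unfolding r2 r_def[symmetric]
  proof (intro exI conjI)
    show "real_of_int ((u - v) * (u + v)) \<in> {x - 4 * r .. x + 4 * r}"
      unfolding n using vd dv r1 by simp
    show "real_of_int (u - v) \<in> {r\<^sup>2 - 4 * r .. r\<^sup>2 + 4 * r}"
      using u v sd r1 by auto
    show "real_of_int (u + v) \<in> {r\<^sup>2 - 4 * r .. r\<^sup>2 + 4 * r}"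
      using u v sd r1 by auto
  qed simp
qed simp_all

text \<open>The quotient of the two sides is
  \<open>c * k * (k * real n) powr (\<alpha> - 1)\<close>, whose exponent is negative, so it tends
  to 0. Used with \<open>\<alpha> = 4 * \<phi>\<close> to make the error terms small against the
  spacing of the points.\<close>

lemma sublinear_powr_less_linear:
  fixes c k \<alpha> :: real
  assumes "\<alpha> < 1" "0 < k"
  shows "\<exists>N. \<forall>n\<ge>N. c * (k * real n) powr \<alpha> < real n"
proof -
  have "filterlim (\<lambda>n. k * real n) at_top sequentially"
    using assms(2) filterlim_real_sequentially
    by (intro filterlim_tendsto_pos_mult_at_top[OF tendsto_const])
  then have "(\<lambda>n. (k * real n) powr (\<alpha> - 1)) \<longlonglongrightarrow> 0"
    using assms(1) by (intro tendsto_neg_powr) auto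
  then have "(\<lambda>n. c * k * (k * real n) powr (\<alpha> - 1)) \<longlonglongrightarrow> 0"
    by (rule tendsto_mult_right_zero)
  then have "\<forall>\<^sub>F n in sequentially. c * k * (k * real n) powr (\<alpha> - 1) < 1"
    by (rule order_tendstoD) simp
  moreover have "\<forall>\<^sub>F n::nat in sequentially. n > 0"
    by (rule eventually_gt_at_top)
  ultimately have "\<forall>\<^sub>F n in sequentially. c * (k * real n) powr \<alpha> < real n"
  proof eventually_elim
    case (elim n)
    have "(k * real n) powr \<alpha> = (k * real n) powr (\<alpha> - 1) * (k * real n)"
      using assms(2) elim(2) by (simp add: powr_diff)
    then have "c * (k * real n) powr \<alpha> = (c * k * (k * real n) powr (\<alpha> - 1)) * real n"
      by simp
    also have "\<dots> < 1 * real n"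
      using elim by (intro mult_strict_right_mono) auto
    finally show ?case by simp
  qed
  then show ?thesis
    by (simp add: eventually_sequentially)
qed

text \<open>Expanding cancels \<open>M^4\<close> and leaves
  \<open>(p + q) * M\<^sup>2 + p * q\<close>. Since \<open>p * q\<close> has size at most
  \<open>C\<^sup>2 * M\<^sup>2\<close>, dividing by \<open>M\<^sup>2\<close> gives a bound
  independent of \<open>M\<close>.\<close>

lemma sum_of_deviations_bounded:
  fixes p q M C :: int
  assumes "M > 0" "\<bar>p\<bar> \<le> C * M" "\<bar>q\<bar> \<le> C * M"
    and "\<bar>(M\<^sup>2 + p) * (M\<^sup>2 + q) - M^4\<bar> \<le> 2 * M\<^sup>2"
  shows "\<bar>p + q\<bar> \<le> C\<^sup>2 + 2"
proof -
  have "\<bar>p * q\<bar> \<le> (C * M) * (C * M)"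
    unfolding abs_mult using assms by (intro mult_mono) auto
  moreover have "(M\<^sup>2 + p) * (M\<^sup>2 + q) - M^4 = (p + q) * M\<^sup>2 + p * q"
    by (simp add: algebra_simps power2_eq_square power4_eq_xxxx)
  ultimately have "\<bar>(p + q) * M\<^sup>2\<bar> \<le> (C\<^sup>2 + 2) * M\<^sup>2"
    using assms(4) by (simp add: algebra_simps power2_eq_square)
  then have "\<bar>p + q\<bar> * M\<^sup>2 \<le> (C\<^sup>2 + 2) * M\<^sup>2"
    by (simp add: abs_mult)
  then show ?thesis
    using assms(1) by simp
qed

lemma almost_square_exponent_ge_quarter:
  assumes \<phi>: "0 \<le> \<phi>" and "almost_square_exponent (1/4) \<phi>"
  shows "1/4 \<le> \<phi>"
proof (rule ccontr)
  assume "\<not> 1/4 \<le> \<phi>"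
  then have \<phi>4: "4 * \<phi> < 1" by simp
  obtain c1 c2 :: real where c: "c1 > 0" "c2 > 0"
    and ex: "\<And>x::real. x \<ge> 1 \<Longrightarrow> \<exists>n a b :: int. n = a * b \<and>
      real_of_int n \<in> {x - c1 * x powr \<phi> .. x + c1 * x powr \<phi>} \<and>
      real_of_int a \<in> {x powr (1/2) - c2 * x powr (1/4) .. x powr (1/2) + c2 * x powr (1/4)} \<and>
      real_of_int b \<in> {x powr (1/2) - c2 * x powr (1/4) .. x powr (1/2) + c2 * x powr (1/4)}"
    using assms(2) unfolding almost_square_exponent_def by blast
  \<comment> \<open>The 1 covers the distance from \<open>sqrt (y j)\<close> to
    \<open>M\<^sup>2\<close>, and \<open>2 * c2\<close> comes from the bound \<open>2 * M\<close> on
    the fourth root of \<open>y j\<close>.\<close>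
  define C where "C = nat \<lceil>1 + 2 * c2\<rceil>"
  have C: "1 + 2 * c2 \<le> C" unfolding C_def by linarith
  then have C1: "C \<ge> 1" using c by linarith
  define K where "K = C\<^sup>2 + 2"
  \<comment> \<open>Chosen so that the number of possible pairs \<open>(p, p + q)\<close>, which is
    \<open>(2 * C * M + 1) * (2 * K + 1)\<close>, is at most \<open>D * M\<close>.\<close>
  define D where "D = 3 * C * (2 * K + 1)"
  have D1: "D \<ge> 1" unfolding D_def using C1 by simp
  obtain N where N: "\<And>n. n \<ge> N \<Longrightarrow> 2 * c1 * ((2 * real D) * real n) powr (4 * \<phi>) < real n"
    using sublinear_powr_less_linear[OF \<phi>4, of "2 * real D" "2 * c1"] D1 by auto
  \<comment> \<open>The spacing \<open>L\<close> is the fraction 1/\<open>D\<close> of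
    \<open>M\<close>, so \<open>D * M\<close> steps of length \<open>L\<close> lead from
    \<open>M^4\<close> exactly to \<open>M^4 + M\<^sup>2\<close>. Adding 1 to \<open>N\<close> keeps
    \<open>L\<close> positive.\<close>
  define L where "L = N + 1"
  define M where "M = D * L"
  have L1: "L \<ge> 1" unfolding L_def by simp
  have M1: "M \<ge> 1" unfolding M_def using L1 D1 by simp
  have LM: "L \<le> M" unfolding M_def using D1 by simp
  have MM: "M \<le> M\<^sup>2" using M1 by (simp add: power2_eq_square)
  \<comment> \<open>A bound for the error \<open>c1 * y j powr \<phi>\<close> that is uniform in
    \<open>j\<close>, because every point is at most \<open>(2 * M)^4\<close>.\<close>
  define B where "B = c1 * (2 * real M) powr (4 * \<phi>)"
  have B: "2 * B < L"
    using N[of L] unfolding B_def M_def by (simp add: L_def algebra_simps)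
  define y where "y j = M^4 + j * L" for j
  have "\<exists>p q :: int. \<bar>p\<bar> \<le> C * M \<and> \<bar>p + q\<bar> \<le> K \<and>
      2 * \<bar>(real M^2 + p) * (real M^2 + q) - real (y j)\<bar> < L" if j: "j \<le> D * M" for j
  proof -
    have "j * L \<le> D * M * L" using j by simp
    also have "\<dots> = M\<^sup>2" unfolding M_def by (simp add: power2_eq_square)
    finally have jL: "j * L \<le> M\<^sup>2" .
    have y_ge: "(real M)^4 \<le> y j" unfolding y_def by simp
    have "real (y j) \<le> real (M^4 + M\<^sup>2)"
      unfolding y_def using jL by (subst of_nat_le_iff) simp
    then have y_le: "real (y j) \<le> real M^4 + real M^2" by simp
    have M24: "real M^2 \<le> real M^4" using M1 by (intro power_increasing) auto
    have y1: "real (y j) \<ge> 1"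
      using y_ge M1 one_le_power[of "real M" 4] by linarith
    have y_le2: "real (y j) \<le> (2 * real M)^4"
      using y_le M24 by (simp add: power_mult_distrib)
    have pw: "((2 * real M)^4) powr \<alpha> = (2 * real M) powr (4 * \<alpha>)" for \<alpha>
      using M1 powr_powr[of "2 * real M" 4 \<alpha>] powr_realpow[of "2 * real M" 4] by simp
    have y\<phi>: "real (y j) powr \<phi> \<le> (2 * real M) powr (4 * \<phi>)"
      using powr_mono2[OF \<phi> _ y_le2] unfolding pw by simp
    have y4: "real (y j) powr (1/4) \<le> 2 * real M"
      using powr_mono2[of "1/4", OF _ _ y_le2] M1 unfolding pw by simp
    have y2: "real (y j) powr (1/2) = sqrt (y j)"
      by (simp add: powr_half_sqrt)
    have y2_ge: "real M^2 \<le> sqrt (y j)"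
      using y_ge by (intro real_le_rsqrt) (simp flip: power_mult)
    have "(real M^2 + 1)^2 = real M^4 + 2 * real M^2 + 1"
      by (simp add: power2_sum flip: power_mult)
    then have "real (y j) \<le> (real M^2 + 1)^2"
      using y_le zero_le_power2[of "real M"] by linarith
    then have y2_le: "sqrt (y j) \<le> real M^2 + 1"
      by (intro real_le_lsqrt) auto
    obtain n a b :: int where n: "n = a * b"
      and n_in: "real_of_int n \<in> {y j - c1 * y j powr \<phi> .. y j + c1 * y j powr \<phi>}"
      and a: "real_of_int a \<in> {y j powr (1/2) - c2 * y j powr (1/4) .. y j powr (1/2) + c2 * y j powr (1/4)}"
      and b: "real_of_int b \<in> {y j powr (1/2) - c2 * y j powr (1/4) .. y j powr (1/2) + c2 * y j powr (1/4)}"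
      using ex[OF y1] by blast
    have c2y: "c2 * y j powr (1/4) \<le> 2 * c2 * M"
      using mult_left_mono[OF y4, of c2] c by simp
    have "(1 + 2 * c2) * real M \<le> C * real M"
      using C by (intro mult_right_mono) auto
    then have CM: "1 + 2 * c2 * real M \<le> C * real M"
      using M1 by (simp add: algebra_simps)
    have dev: "\<bar>z - int M^2\<bar> \<le> int (C * M)"
      if "real_of_int z \<in> {y j powr (1/2) - c2 * y j powr (1/4) .. y j powr (1/2) + c2 * y j powr (1/4)}" for z
    proof -
      have "\<bar>real_of_int z - real M^2\<bar> \<le> C * real M"
        using that c2y CM y2_ge y2_le unfolding y2 atLeastAtMost_iff by linarith
      then have "real_of_int \<bar>z - int M^2\<bar> \<le> real_of_int (int (C * M))"
        by simp
      then show ?thesis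
        by (simp only: of_int_le_iff)
    qed
    define p where "p = a - int M^2"
    define q where "q = b - int M^2"
    have p: "\<bar>p\<bar> \<le> int (C * M)" and q: "\<bar>q\<bar> \<le> int (C * M)"
      unfolding p_def q_def using dev a b by blast+
    have "c1 * y j powr \<phi> \<le> B"
      unfolding B_def using y\<phi> c by simp
    moreover have "\<bar>real_of_int n - y j\<bar> \<le> c1 * y j powr \<phi>"
      using n_in unfolding atLeastAtMost_iff abs_le_iff by linarith
    ultimately have "\<bar>real_of_int n - y j\<bar> \<le> B"
      by (rule order_trans[rotated])
    then have close: "2 * \<bar>real_of_int n - y j\<bar> < L"
      using B by simp
    have "real L \<le> real M^2" using LM MM by (metis of_nat_le_iff of_nat_power order_trans)
    \<comment> \<open>One \<open>M\<^sup>2\<close> accounts for the distance from \<open>y j\<close>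
      to \<open>M^4\<close>, the other absorbs the error, which is below
      \<open>L / 2\<close>.\<close>
    then have "\<bar>real_of_int n - real M^4\<bar> \<le> 2 * real M^2"
      using close y_ge y_le by (smt (verit) of_nat_0_le_iff)
    then have "\<bar>real_of_int (n - int M^4)\<bar> \<le> real_of_int (2 * int M^2)"
      by simp
    then have "\<bar>n - int M^4\<bar> \<le> 2 * int M^2"
      by linarith
    then have "\<bar>p + q\<bar> \<le> int C^2 + 2"
      using p q M1 n by (intro sum_of_deviations_bounded[of "int M"]) (auto simp: p_def q_def)
    then have "\<bar>p + q\<bar> \<le> K" unfolding K_def by simp
    moreover have "(real M^2 + p) * (real M^2 + q) = n"
      unfolding p_def q_def n by simp
    ultimately show ?thesis using p close by metis
  qed
  then obtain p q :: "nat \<Rightarrow> int" where p: "\<And>j. j \<le> D * M \<Longrightarrow> \<bar>p j\<bar> \<le> C * M"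
    and pq: "\<And>j. j \<le> D * M \<Longrightarrow> \<bar>p j + q j\<bar> \<le> K"
    and close: "\<And>j. j \<le> D * M \<Longrightarrow> 2 * \<bar>(real M^2 + p j) * (real M^2 + q j) - real (y j)\<bar> < L"
    by metis
  \<comment> \<open>Equal pairs yield the same product, which would lie within \<open>L / 2\<close>
    of two points at least \<open>L\<close> apart. Recording \<open>p + q\<close> instead of
    \<open>q\<close> makes the second coordinate range over boundedly many values, so the target has
    O(\<open>M\<close>) rather than O(\<open>M\<^sup>2\<close>) elements.\<close>
  have "inj_on (\<lambda>j. (p j, p j + q j)) {..D * M}"
  proof (rule linorder_inj_onI)
    fix i j assume ij: "i < j" "i \<in> {..D * M}" "j \<in> {..D * M}"
    show "(p i, p i + q i) \<noteq> (p j, p j + q j)"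
    proof
      assume "(p i, p i + q i) = (p j, p j + q j)"
      then have eq: "p i = p j" "q i = q j" by auto
      define z where "z = (real M^2 + p j) * (real M^2 + q j)"
      have "2 * \<bar>z - y i\<bar> < L" "2 * \<bar>z - y j\<bar> < L"
        using close[of i] close[of j] ij unfolding eq z_def by simp_all
      then have "\<bar>real (y i) - real (y j)\<bar> < L"
        by (smt (verit))
      moreover have "(i + 1) * L \<le> j * L" using ij by (intro mult_right_mono) auto
      then have "y i + L \<le> y j" unfolding y_def by simp
      ultimately show False by linarith
    qed
  qed auto
  moreover have "(\<lambda>j. (p j, p j + q j)) ` {..D * M} \<subseteq> {- int (C * M)..int (C * M)} \<times> {- int K..int K}"
    using p pq by (force simp: abs_le_iff)
  ultimately have "card {..D * M} \<le> card ({- int (C * M)..int (C * M)} \<times> {- int K..int K})"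
    by (intro card_inj_on_le) auto
  also have "\<dots> = (2 * (C * M) + 1) * (2 * K + 1)"
    by (simp add: card_cartesian_product nat_add_distrib nat_mult_distrib)
  also have "\<dots> \<le> (3 * (C * M)) * (2 * K + 1)"
    using C1 M1 by (intro mult_right_mono) auto
  also have "\<dots> = D * M" unfolding D_def by (simp add: algebra_simps)
  \<comment> \<open>The indices start at 0, so \<open>{..D * M}\<close> has \<open>D * M + 1\<close>
    elements, one too many.\<close>
  finally show False by simp
qed

theorem theorem3: "f (1/4) = 1/4"
  unfolding f_def
  by (rule cInf_eq_minimum) (use almost_square_exponent_quarter almost_square_exponent_ge_quarter in auto)

end
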